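(* Let $\Lambda=\{\lambda_j\}_{j\in\mathbb N}\subset[0,1)$ be a sequence of pairwise distinct points that is a finite union of Carleson sequences, and let $p>0$. Enumerate $\Lambda^p=\{\lambda_j^p\}_{j\in\mathbb N}$ according to the same index set. Then $$H^2(\Lambda)=H^2(\Lambda^p),$$ that is, as sets of complex sequences indexed by $\mathbb N$, $\{\{f(\lambda_j)\}_{j\in\mathbb N}:f\in H^2(\mathbb D)\}=\{\{f(\lambda_j^p)\}_{j\in\mathbb N}:f\in H^2(\mathbb D)\}$.
   Context: $\mathbb N=\{0,1,2,\dots\}$, $\mathbb D=\{z\in\mathbb C:|z|<1\}$. The Hardy space $H^2(\mathbb D)$ consists of all analytic functions $f(z)=\sum_{n\ge0}c_nz^n$ on $\mathbb D$ with $\sum_{n\ge 0}|c_n|^2<\infty$. For an indexed sequence $\Gamma=\{\gamma_j\}_{j\in\mathbb N}\subset\mathbb D$, the trace space is $H^2(\Gamma):=\{\{f(\gamma_j)\}_{j\in\mathbb N}:f\in H^2(\mathbb D)\}$. For $\lambda,z\in\mathbb D$ let $\rho(\lambda,z)=\left|\frac{\lambda-z}{1-\overline\lambda z}\right|$. A (countably infinite) sequence $\{\lambda_j\}_j\subset\mathbb D$ of pairwise distinct points is a Carleson sequence if $\inf_{j}\prod_{i\ne j}\rho(\lambda_i,\lambda_j)>0$. "Finite union of Carleson sequences" means that the underlying set of points is the union of finitely many Carleson sequences. *)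

theory Defs
  imports "HOL-Complex_Analysis.Complex_Analysis"
begin

text \<open>
  Functions on the disc are total functions on the complex plane; their values outside the
  open unit disc are unconstrained and never used.
\<close>
definition hardy_H2 :: "(complex \<Rightarrow> complex) set" where
  "hardy_H2 = {f. f analytic_on ball 0 1 \<and>
     (\<exists>c :: nat \<Rightarrow> complex. (\<forall>z\<in>ball 0 1. (\<lambda>n. c n * z ^ n) sums f z) \<and>
        summable (\<lambda>n. (cmod (c n))\<^sup>2))}"

definition H2_trace :: "(nat \<Rightarrow> complex) \<Rightarrow> (nat \<Rightarrow> complex) set" where
  "H2_trace \<gamma> = {(\<lambda>j. f (\<gamma> j)) | f. f \<in> hardy_H2}"

definition pseudohyp_dist :: "complex \<Rightarrow> complex \<Rightarrow> real" where
  "pseudohyp_dist w z = cmod ((w - z) / (1 - cnj w * z))"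

text \<open>
  The infinite product over \<open>i \<noteq> j\<close> is the limit of its partial products.  Its factors lie in
  \<open>[0, 1]\<close>, so this limit always exists, possibly as \<open>0\<close>.  The library's \<^const>\<open>prodinf\<close>
  is not used because a product of nonzero factors that tends to \<open>0\<close> has no value there.
\<close>
definition carleson_seq :: "(nat \<Rightarrow> complex) \<Rightarrow> bool" where
  "carleson_seq \<mu> \<longleftrightarrow> inj \<mu> \<and> range \<mu> \<subseteq> ball 0 1 \<and>
     (INF j. lim (\<lambda>n. \<Prod>i\<in>{..<n} - {j}. pseudohyp_dist (\<mu> i) (\<mu> j))) > 0"

definition finite_union_carleson :: "complex set \<Rightarrow> bool" where
  "finite_union_carleson S \<longleftrightarrow>
     (\<exists>M :: (nat \<Rightarrow> complex) set. finite M \<and> (\<forall>\<mu>\<in>M. carleson_seq \<mu>) \<and> S = (\<Union>\<mu>\<in>M. range \<mu>))"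

end

theory Submission
  imports Defs
begin

text \<open>
  Write \<open>x\<^sub>j\<close> for the points. All of them are real, so a function of \<open>H\<^sup>2\<close> can be replaced by the
  real and imaginary parts of its coefficient sequence, and its value at \<open>x\<close> becomes the inner
  product of a real \<open>\<ell>\<^sup>2\<close> sequence with the geometric sequence \<open>k\<^sub>x = (x\<^sup>n)\<^sub>n\<close>. By duality
  (\<open>inner_interpolation_of_bounded_functional\<close>), every trace on the points \<open>x\<^sub>j\<^sup>p\<close> is a trace on the
  points \<open>x\<^sub>j\<close> as soon as
  \<open>\<parallel>\<Sum>\<^sub>j a\<^sub>j k\<^bsub>x\<^sub>j\<^sup>p\<^esub>\<parallel> \<le> C \<parallel>\<Sum>\<^sub>j a\<^sub>j k\<^bsub>x\<^sub>j\<^esub>\<parallel>\<close> for all finite sums, with one constant \<open>C\<close>. The reverse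
  inclusion is the same statement for the points \<open>x\<^sub>j\<^sup>p\<close> and the exponent \<open>1/p\<close>.

  In terms of the exponential sum \<open>F(t) = \<Sum>\<^sub>j a\<^sub>j x\<^sub>j\<^sup>t\<close> the estimate compares the samples of \<open>F\<close> at
  the multiples of \<open>p\<close> with those at the integers. It rests on an inequality of Newman type: the
  difference \<open>F(n) - F(n+1)\<close> has small \<open>\<ell>\<^sup>2\<close> norm relative to \<open>F(n)\<close> when
  \<open>\<Sum>\<^sub>j (1 - x\<^sub>j)\<close> is small (\<open>norm_geom_sum_nodes_diff_le\<close>). Then \<open>F(m + r)\<close> with \<open>0 \<le> r < 1\<close> is a
  rapidly convergent binomial series in iterated differences of \<open>F\<close> at the integer \<open>m\<close>, which gives
  the estimate (\<open>norm_geom_sum_powr_le_of_small\<close>).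

  A Carleson sequence satisfies the Blaschke condition \<open>\<Sum>\<^sub>j (1 - |x\<^sub>j|) < \<infinity>\<close>, because positivity of
  the product of the pseudohyperbolic distances \<open>\<rho>(x\<^sub>i, x\<^sub>0)\<close> bounds the sum of their deficits from
  one, and the condition passes to finite unions and to the powers \<open>x\<^sub>j\<^sup>p\<close>. Hence all but finitely
  many points satisfy the smallness requirement. The remaining points are put back one at a time: by
  the Blaschke condition the products of pseudohyperbolic distances from a new point to the others
  stay away from zero, so its coefficient is controlled by the norm of the sum
  (\<open>norm_geom_sum_powr_le\<close>).
\<close>

section \<open>The Hilbert space of square-summable real sequences\<close>

text \<open>
  Making the sequences a type turns them into an instance of the inner product and completeness
  classes, so that the general theory of Hilbert spaces applies to them.
\<close>
typedef ell2 = "{x :: nat \<Rightarrow> real. summable (\<lambda>n. (x n)\<^sup>2)}"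
  morphisms coord Ell2
  by (intro exI[of _ "\<lambda>_. 0"]) simp

setup_lifting type_definition_ell2

lemma summable_square_add:
  fixes x y :: "nat \<Rightarrow> real"
  assumes "summable (\<lambda>n. (x n)\<^sup>2)" "summable (\<lambda>n. (y n)\<^sup>2)"
  shows "summable (\<lambda>n. (x n + y n)\<^sup>2)"
proof (rule summable_comparison_test)
  have "(x n + y n)\<^sup>2 \<le> 2 * (x n)\<^sup>2 + 2 * (y n)\<^sup>2" for n
    using zero_le_power2[of "x n - y n"] by (simp add: power2_eq_square algebra_simps)
  then show "\<exists>N. \<forall>n\<ge>N. norm ((x n + y n)\<^sup>2) \<le> 2 * (x n)\<^sup>2 + 2 * (y n)\<^sup>2"
    by simp
  show "summable (\<lambda>n. 2 * (x n)\<^sup>2 + 2 * (y n)\<^sup>2)"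
    using assms by (intro summable_add summable_mult)
qed

lemma summable_mult_of_square_summable:
  fixes x y :: "nat \<Rightarrow> real"
  assumes "summable (\<lambda>n. (x n)\<^sup>2)" "summable (\<lambda>n. (y n)\<^sup>2)"
  shows "summable (\<lambda>n. x n * y n)"
proof (rule summable_comparison_test)
  have "\<bar>x n * y n\<bar> \<le> (x n)\<^sup>2 + (y n)\<^sup>2" for n
  proof -
    have "2 * (\<bar>x n\<bar> * \<bar>y n\<bar>) \<le> (x n)\<^sup>2 + (y n)\<^sup>2"
      using zero_le_power2[of "\<bar>x n\<bar> - \<bar>y n\<bar>"] by (simp add: power2_diff)
    moreover have "0 \<le> \<bar>x n\<bar> * \<bar>y n\<bar>" by simp
    ultimately show ?thesis unfolding abs_mult by linarith
  qed
  then show "\<exists>N. \<forall>n\<ge>N. norm (x n * y n) \<le> (x n)\<^sup>2 + (y n)\<^sup>2"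
    by simp
  show "summable (\<lambda>n. (x n)\<^sup>2 + (y n)\<^sup>2)"
    using assms by (rule summable_add)
qed

instantiation ell2 :: real_inner
begin

lift_definition zero_ell2 :: ell2 is "\<lambda>_. 0" by simp
lift_definition plus_ell2 :: "ell2 \<Rightarrow> ell2 \<Rightarrow> ell2" is "\<lambda>x y n. x n + y n"
  by (rule summable_square_add)
lift_definition uminus_ell2 :: "ell2 \<Rightarrow> ell2" is "\<lambda>x n. - x n" by simp
lift_definition scaleR_ell2 :: "real \<Rightarrow> ell2 \<Rightarrow> ell2" is "\<lambda>r x n. r * x n"
  by (simp add: power_mult_distrib summable_mult)
definition minus_ell2 :: "ell2 \<Rightarrow> ell2 \<Rightarrow> ell2" where "minus_ell2 x y = x + - y"
lift_definition inner_ell2 :: "ell2 \<Rightarrow> ell2 \<Rightarrow> real" is "\<lambda>x y. \<Sum>n. x n * y n" .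
definition norm_ell2 :: "ell2 \<Rightarrow> real" where "norm_ell2 x = sqrt (inner x x)"
definition sgn_ell2 :: "ell2 \<Rightarrow> ell2" where "sgn_ell2 x = scaleR (inverse (norm x)) x"
definition dist_ell2 :: "ell2 \<Rightarrow> ell2 \<Rightarrow> real" where "dist_ell2 x y = norm (x - y)"
definition [code del]:
  "(uniformity :: (ell2 \<times> ell2) filter) = (INF e\<in>{0 <..}. principal {(x, y). dist x y < e})"
definition open_ell2 :: "ell2 set \<Rightarrow> bool"
  where [code del]: "open_ell2 S = (\<forall>x\<in>S. \<forall>\<^sub>F (x', y) in uniformity. x' = x \<longrightarrow> y \<in> S)"

instance
proof
  fix x y z :: ell2 and r s :: real
  show "x + y + z = x + (y + z)" by transfer (simp add: add.assoc)
  show "x + y = y + x" by transfer (simp add: add.commute)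
  show "0 + x = x" by transfer simp
  show "- x + x = 0" by transfer simp
  show "x - y = x + - y" by (rule minus_ell2_def)
  show "r *\<^sub>R (x + y) = r *\<^sub>R x + r *\<^sub>R y" by transfer (simp add: algebra_simps)
  show "(r + s) *\<^sub>R x = r *\<^sub>R x + s *\<^sub>R x" by transfer (simp add: algebra_simps)
  show "r *\<^sub>R s *\<^sub>R x = (r * s) *\<^sub>R x" by transfer (simp add: algebra_simps)
  show "1 *\<^sub>R x = x" by transfer simp
  show "sgn x = inverse (norm x) *\<^sub>R x" by (rule sgn_ell2_def)
  show "dist x y = norm (x - y)" by (rule dist_ell2_def)
  show "(uniformity :: (ell2 \<times> ell2) filter) = (INF e\<in>{0 <..}. principal {(x, y). dist x y < e})"
    by (rule uniformity_ell2_def)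
  show "open U = (\<forall>x\<in>U. \<forall>\<^sub>F (x', y) in uniformity. x' = x \<longrightarrow> y \<in> U)" for U :: "ell2 set"
    by (rule open_ell2_def)
  show "inner x y = inner y x" by transfer (simp add: mult.commute)
  show "inner (x + y) z = inner x z + inner y z"
    by transfer (simp add: distrib_right suminf_add summable_mult_of_square_summable)
  show "inner (r *\<^sub>R x) y = r * inner x y"
    by transfer (simp add: mult.assoc suminf_mult summable_mult_of_square_summable)
  show "0 \<le> inner x x"
    by transfer (simp add: suminf_nonneg flip: power2_eq_square)
  show "(inner x x = 0) = (x = 0)"
    by transfer (simp add: suminf_eq_zero_iff fun_eq_iff flip: power2_eq_square)
  show "norm x = sqrt (inner x x)" by (rule norm_ell2_def)
qed

end

lemma coord_add [simp]: "coord (x + y) n = coord x n + coord y n"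
  by transfer simp

lemma coord_scaleR [simp]: "coord (r *\<^sub>R x) n = r * coord x n"
  by transfer simp

lemma coord_zero [simp]: "coord 0 n = 0"
  by transfer simp

lemma coord_diff [simp]: "coord (x - y) n = coord x n - coord y n"
  using coord_add[of "x - y" y n] by simp

lemma coord_sum [simp]: "coord (sum f J) n = (\<Sum>j\<in>J. coord (f j) n)"
  by (induction J rule: infinite_finite_induct) simp_all

lemma summable_coord_square: "summable (\<lambda>n. (coord x n)\<^sup>2)"
  using coord[of x] by simp

lemma inner_ell2_sums: "(\<lambda>n. coord x n * coord y n) sums inner x y"
  unfolding inner_ell2.rep_eq
  by (intro summable_sums summable_mult_of_square_summable summable_coord_square)

lemma norm_ell2_sums: "(\<lambda>n. (coord x n)\<^sup>2) sums (norm x)\<^sup>2"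
  using inner_ell2_sums[of x x] by (simp add: power2_norm_eq_inner flip: power2_eq_square)

lemma sum_coord_square_le: "finite A \<Longrightarrow> (\<Sum>n\<in>A. (coord x n)\<^sup>2) \<le> (norm x)\<^sup>2"
  using sum_le_suminf[OF summable_coord_square, of A x] norm_ell2_sums[of x]
  by (simp add: sums_iff)

lemma abs_coord_le_norm: "\<bar>coord x n\<bar> \<le> norm x"
  using sum_coord_square_le[of "{n}" x] by (simp add: abs_le_square_iff[symmetric])

text \<open>
  Norm bounds are checked on initial segments, where pointwise limits may be taken under the sum.
\<close>
lemma norm_ell2_le:
  assumes "\<And>N. (\<Sum>n<N. (coord x n)\<^sup>2) \<le> B\<^sup>2" "0 \<le> B"
  shows "norm x \<le> B"
proof (rule power2_le_imp_le)
  show "(norm x)\<^sup>2 \<le> B\<^sup>2"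
    using norm_ell2_sums[of x] unfolding sums_def
    by (rule LIMSEQ_le_const2) (use assms in auto)
qed (fact assms)

text \<open>
  The limit of a Cauchy sequence is taken entrywise. It is square-summable because the norms are
  bounded, and it is a limit in norm because the Cauchy bound holds on every initial segment.
\<close>
instance ell2 :: complete_space
proof
  fix X :: "nat \<Rightarrow> ell2"
  assume X: "Cauchy X"
  have "Cauchy (\<lambda>k. coord (X k) n)" for n
    unfolding Cauchy_altdef
  proof (intro allI impI)
    fix e :: real assume "e > 0"
    then obtain M where M: "\<And>m k. m \<ge> M \<Longrightarrow> k > m \<Longrightarrow> dist (X m) (X k) < e"
      using X unfolding Cauchy_altdef by blast
    have "dist (coord (X m) n) (coord (X k) n) < e" if "m \<ge> M" "k > m" for m k
      using M[OF that] abs_coord_le_norm[of "X m - X k" n] by (simp add: dist_norm)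
    then show "\<exists>M. \<forall>m\<ge>M. \<forall>k>m. dist (coord (X m) n) (coord (X k) n) < e"
      by blast
  qed
  moreover define c where "c = (\<lambda>n. lim (\<lambda>k. coord (X k) n))"
  ultimately have c: "\<And>n. (\<lambda>k. coord (X k) n) \<longlonglongrightarrow> c n"
    by (simp add: real_Cauchy_convergent flip: convergent_LIMSEQ_iff)
  from Cauchy_Bseq[OF X] obtain B where B: "0 < B" "\<And>k. norm (X k) \<le> B"
    by (auto simp: Bseq_def)
  have "(\<Sum>n<N. (c n)\<^sup>2) \<le> B\<^sup>2" for N
  proof (rule LIMSEQ_le_const2)
    show "(\<lambda>k. \<Sum>n<N. (coord (X k) n)\<^sup>2) \<longlonglongrightarrow> (\<Sum>n<N. (c n)\<^sup>2)"
      by (intro tendsto_sum tendsto_power c)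
    show "\<exists>K. \<forall>k\<ge>K. (\<Sum>n<N. (coord (X k) n)\<^sup>2) \<le> B\<^sup>2"
      using sum_coord_square_le[of "{..<N}"] B
      by (intro exI[of _ 0] allI impI order_trans[OF sum_coord_square_le] power_mono) auto
  qed
  then have "summable (\<lambda>n. (c n)\<^sup>2)"
    by (intro summableI_nonneg_bounded) auto
  then have c': "coord (Ell2 c) = c"
    by (simp add: Ell2_inverse)
  have "X \<longlonglongrightarrow> Ell2 c"
  proof (rule metric_LIMSEQ_I)
    fix e :: real assume "e > 0"
    then obtain M where M: "\<And>m k. m \<ge> M \<Longrightarrow> k \<ge> M \<Longrightarrow> dist (X m) (X k) < e / 2"
      using X unfolding Cauchy_def by (metis half_gt_zero)
    have "dist (X m) (Ell2 c) < e" if "m \<ge> M" for m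
    proof -
      have "norm (X m - Ell2 c) \<le> e / 2"
      proof (rule norm_ell2_le)
        fix N
        show "(\<Sum>n<N. (coord (X m - Ell2 c) n)\<^sup>2) \<le> (e / 2)\<^sup>2"
        proof (rule LIMSEQ_le_const2)
          show "(\<lambda>k. \<Sum>n<N. (coord (X m - X k) n)\<^sup>2)
              \<longlonglongrightarrow> (\<Sum>n<N. (coord (X m - Ell2 c) n)\<^sup>2)"
            by (simp add: c') (intro tendsto_sum tendsto_power tendsto_diff tendsto_const c)
          have "(\<Sum>n<N. (coord (X m - X k) n)\<^sup>2) \<le> (e / 2)\<^sup>2" if "k \<ge> M" for k
          proof -
            have "norm (X m - X k) \<le> e / 2"
              using M[OF \<open>m \<ge> M\<close> that] by (simp add: dist_norm)
            then show ?thesis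
              by (intro order_trans[OF sum_coord_square_le] power_mono) auto
          qed
          then show "\<exists>K. \<forall>k\<ge>K. (\<Sum>n<N. (coord (X m - X k) n)\<^sup>2) \<le> (e / 2)\<^sup>2"
            by blast
        qed
      qed (use \<open>e > 0\<close> in simp)
      then show ?thesis using \<open>e > 0\<close> by (simp add: dist_norm)
    qed
    then show "\<exists>M. \<forall>m\<ge>M. dist (X m) (Ell2 c) < e" by blast
  qed
  then show "convergent X" by (rule convergentI)
qed

section \<open>Interpolation from bounded functionals\<close>

text \<open>
  This is the Riesz representation theorem for a functional that is only given by its values on a
  family of vectors. It sends \<open>u j\<close> to \<open>w j\<close>, and the bound makes it well defined and continuous on
  the span. The representing vector minimises \<open>\<parallel>x\<parallel>\<^sup>2 - 2 W\<close> over the pairs \<open>(x, W)\<close> in the graph of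
  the functional.
\<close>
lemma inner_interpolation_of_bounded_functional:
  fixes u :: "'i \<Rightarrow> 'a::{real_inner, complete_space}" and w :: "'i \<Rightarrow> real"
  assumes bound: "\<And>J a. finite J \<Longrightarrow>
    (\<Sum>j\<in>J. a j * w j) \<le> M * norm (\<Sum>j\<in>J. a j *\<^sub>R u j)"
  shows "\<exists>d. \<forall>j. inner d (u j) = w j"
proof -
  define g where "g = (\<lambda>j. (u j, w j))"
  define G where "G = span (range g)"
  define \<Phi> where "\<Phi> = (\<lambda>v :: 'a \<times> real. (norm (fst v))\<^sup>2 - 2 * snd v)"
  have g_in_G: "g j \<in> G" for j
    unfolding G_def by (intro span_base) simp
  have snd_le: "snd v \<le> M * norm (fst v)" if "v \<in> G" for v
  proof -
    from that obtain t r where t: "finite t" "t \<subseteq> range g" and v: "v = (\<Sum>b\<in>t. r b *\<^sub>R b)"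
      unfolding G_def span_explicit by blast
    from t(2) obtain J where J: "inj_on g J" "t = g ` J"
      unfolding subset_image_inj by blast
    have "finite J" using t(1) J finite_image_iff by blast
    have "v = (\<Sum>j\<in>J. r (g j) *\<^sub>R g j)"
      unfolding v J(2) by (simp add: sum.reindex[OF J(1)])
    then have "fst v = (\<Sum>j\<in>J. r (g j) *\<^sub>R u j)" "snd v = (\<Sum>j\<in>J. r (g j) * w j)"
      by (simp_all add: fst_sum snd_sum g_def)
    with bound[OF \<open>finite J\<close>] show ?thesis by simp
  qed
  have \<Phi>_lower: "- M\<^sup>2 \<le> \<Phi> v" if "v \<in> G" for v
    using snd_le[OF that] zero_le_power2[of "norm (fst v) - M"]
    by (simp add: \<Phi>_def power2_diff mult.commute)
  define I where "I = Inf (\<Phi> ` G)"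
  have I_le: "I \<le> \<Phi> v" if "v \<in> G" for v
    unfolding I_def using that \<Phi>_lower by (intro cInf_lower) (auto intro!: bdd_belowI2)
  have "\<exists>v\<in>G. \<Phi> v < I + inverse (real (Suc k))" for k
  proof -
    have "\<Phi> ` G \<noteq> {}" using g_in_G by blast
    then have "\<exists>y\<in>\<Phi> ` G. y < I + inverse (real (Suc k))"
      unfolding I_def by (rule cInf_lessD) simp
    then show ?thesis by blast
  qed
  then obtain v where v: "\<And>k. v k \<in> G" "\<And>k. \<Phi> (v k) < I + inverse (real (Suc k))"
    by metis
  define x where "x = (\<lambda>k. fst (v k))"
  \<comment> \<open>A minimising sequence is Cauchy by the parallelogram law, because the midpoint of two graph
    points again lies in the graph.\<close>
  have dist_x: "(norm (x m - x k))\<^sup>2 \<le> 2 * (inverse (real (Suc m)) + inverse (real (Suc k)))" for m k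
  proof -
    have "(1/2) *\<^sub>R (v m + v k) \<in> G"
      using v(1) unfolding G_def by (intro span_scale span_add)
    from I_le[OF this]
    have "I \<le> (norm (x m + x k))\<^sup>2 / 4 - (snd (v m) + snd (v k))"
      by (simp add: \<Phi>_def x_def power_divide add_divide_distrib)
    moreover have "(norm (x m))\<^sup>2 - 2 * snd (v m) \<le> I + inverse (real (Suc m))"
      "(norm (x k))\<^sup>2 - 2 * snd (v k) \<le> I + inverse (real (Suc k))"
      using v(2)[of m] v(2)[of k] unfolding \<Phi>_def x_def by linarith+
    moreover have "(norm (x m - x k))\<^sup>2 = 2 * (norm (x m))\<^sup>2 + 2 * (norm (x k))\<^sup>2 - (norm (x m + x k))\<^sup>2"
      by (simp add: power2_norm_eq_inner inner_add_left inner_add_right inner_diff_left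
          inner_diff_right inner_commute)
    ultimately show ?thesis by argo
  qed
  have "Cauchy x"
  proof (rule metric_CauchyI)
    fix e :: real assume "e > 0"
    then obtain K where K: "inverse (real (Suc K)) < e\<^sup>2 / 4"
      using reals_Archimedean[of "e\<^sup>2 / 4"] by auto
    have "dist (x m) (x k) < e" if "m \<ge> K" "k \<ge> K" for m k
    proof (rule power2_less_imp_less)
      have "inverse (real (Suc m)) \<le> inverse (real (Suc K))"
        "inverse (real (Suc k)) \<le> inverse (real (Suc K))"
        using that by (intro le_imp_inverse_le; simp)+
      then show "(dist (x m) (x k))\<^sup>2 < e\<^sup>2"
        using dist_x[of m k] K unfolding dist_norm by argo
    qed (use \<open>e > 0\<close> in simp)
    then show "\<exists>K. \<forall>m\<ge>K. \<forall>k\<ge>K. dist (x m) (x k) < e" by blast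
  qed
  then obtain d where d: "x \<longlonglongrightarrow> d"
    using Cauchy_convergent_iff convergent_def by blast
  have "inner d (u j) = w j" for j
  proof -
    define \<delta> c where "\<delta> = inner d (u j) - w j" and "c = (norm (u j))\<^sup>2"
    \<comment> \<open>A step of length \<open>t\<close> in the direction \<open>u j\<close> cannot go below the infimum, so the
      derivative of the quadratic functional at the limit vanishes.\<close>
    have nonneg: "0 \<le> 2 * t * \<delta> + t\<^sup>2 * c" for t
    proof (rule LIMSEQ_le_const)
      show "(\<lambda>k. inverse (real (Suc k)) + 2 * t * (inner (x k) (u j) - w j) + t\<^sup>2 * c)
          \<longlonglongrightarrow> 2 * t * \<delta> + t\<^sup>2 * c"
        using tendsto_add[OF tendsto_add[OF LIMSEQ_inverse_real_of_nat
            tendsto_mult[OF tendsto_const tendsto_diff[OF tendsto_inner[OF d tendsto_const] tendsto_const]]]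
            tendsto_const, of "2 * t" "u j" "w j" "t\<^sup>2 * c"]
        by (simp add: \<delta>_def)
      have "0 \<le> inverse (real (Suc k)) + 2 * t * (inner (x k) (u j) - w j) + t\<^sup>2 * c" for k
      proof -
        have "v k + t *\<^sub>R g j \<in> G"
          using v(1) g_in_G unfolding G_def by (intro span_add span_scale)
        from I_le[OF this]
        have "I \<le> (norm (x k + t *\<^sub>R u j))\<^sup>2 - 2 * (snd (v k) + t * w j)"
          by (simp add: \<Phi>_def x_def g_def)
        also have "(norm (x k + t *\<^sub>R u j))\<^sup>2 = (norm (x k))\<^sup>2 + 2 * t * inner (x k) (u j) + t\<^sup>2 * c"
          unfolding c_def power2_norm_eq_inner
          by (simp add: inner_add_left inner_add_right inner_commute[of "u j" "x k"]
              power2_eq_square algebra_simps)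
        finally have "I \<le> (norm (x k))\<^sup>2 + 2 * t * inner (x k) (u j) + t\<^sup>2 * c - 2 * (snd (v k) + t * w j)" .
        with v(2)[of k] show ?thesis unfolding \<Phi>_def x_def[symmetric] by (simp add: algebra_simps x_def)
      qed
      then show "\<exists>K. \<forall>k\<ge>K. 0 \<le> inverse (real (Suc k)) + 2 * t * (inner (x k) (u j) - w j) + t\<^sup>2 * c"
        by blast
    qed
    have "c \<ge> 0" by (simp add: c_def)
    define s where "s = \<delta> / (c + 1)"
    have \<delta>: "\<delta> = s * (c + 1)" using \<open>c \<ge> 0\<close> by (simp add: s_def)
    have "0 \<le> 2 * (- s) * \<delta> + (- s)\<^sup>2 * c" by (rule nonneg)
    also have "\<dots> = - ((c + 2) * s\<^sup>2)"
      by (simp add: \<delta> power2_eq_square algebra_simps)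
    finally have "s\<^sup>2 \<le> 0"
      using \<open>c \<ge> 0\<close> by (simp add: mult_le_0_iff)
    then show ?thesis using \<delta> by (simp add: \<delta>_def)
  qed
  then show ?thesis by blast
qed

section \<open>Finite sums of geometric sequences\<close>

text \<open>
  This is the reproducing kernel of \<open>H\<^sup>2\<close> at the real point \<open>x\<close>. Outside the disc the geometric
  sequence is not square-summable, and the value is set to zero.
\<close>
lift_definition geom :: "real \<Rightarrow> ell2" is "\<lambda>x n. if \<bar>x\<bar> < 1 then x ^ n else 0"
proof -
  fix x :: real
  show "summable (\<lambda>n. (if \<bar>x\<bar> < 1 then x ^ n else 0)\<^sup>2)"
  proof (cases "\<bar>x\<bar> < 1")
    case True
    then have "x\<^sup>2 < 1" by (simp add: abs_square_less_1)
    then have "summable (\<lambda>n. (x\<^sup>2) ^ n)" by (intro summable_geometric) simp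
    with True show ?thesis by (simp add: power_mult[symmetric] mult.commute)
  qed simp
qed

lemma coord_geom [simp]: "\<bar>x\<bar> < 1 \<Longrightarrow> coord (geom x) n = x ^ n"
  by transfer simp

lemma inner_geom:
  assumes "\<bar>x\<bar> < 1" "\<bar>y\<bar> < 1"
  shows "inner (geom x) (geom y) = 1 / (1 - x * y)"
proof -
  have "\<bar>x * y\<bar> < 1"
    using abs_mult_less[OF assms] by (simp add: abs_mult)
  then have "(\<lambda>n. (x * y) ^ n) sums (1 / (1 - x * y))"
    by (intro geometric_sums) simp
  then show ?thesis
    using inner_ell2_sums[of "geom x" "geom y"] assms
    by (simp add: power_mult_distrib sums_iff)
qed

definition geom_sum :: "('i \<Rightarrow> real) \<Rightarrow> 'i set \<Rightarrow> ('i \<Rightarrow> real) \<Rightarrow> ell2" where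
  "geom_sum x J a = (\<Sum>j\<in>J. a j *\<^sub>R geom (x j))"

lemma norm_geom_sum_power2:
  assumes "\<And>j. j \<in> J \<Longrightarrow> \<bar>x j\<bar> < 1"
  shows "(norm (geom_sum x J a))\<^sup>2 = (\<Sum>i\<in>J. \<Sum>j\<in>J. a i * a j / (1 - x i * x j))"
  unfolding power2_norm_eq_inner geom_sum_def
  using assms by (simp add: inner_sum_left inner_sum_right inner_geom sum_distrib_left mult_ac)

text \<open>
  Multiplying the coefficients by the values of a Blaschke factor at the nodes is a contraction,
  and its defect has rank one. Both follow termwise from the identity
  \<open>1 - b(y) b(z) = (1 - t\<^sup>2)(1 - y z) / ((1 - t y)(1 - t z))\<close> for \<open>b(y) = (y - t)/(1 - t y)\<close>.
  If \<open>t\<close> is itself a node, that node disappears from the sum, which is what inductions on the number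
  of nodes use.
\<close>
lemma norm_geom_sum_Blaschke:
  assumes x: "\<And>j. j \<in> J \<Longrightarrow> \<bar>x j\<bar> < 1" and t: "\<bar>t\<bar> < 1"
  shows "(norm (geom_sum x J a))\<^sup>2 =
    (norm (geom_sum x J (\<lambda>j. a j * ((x j - t) / (1 - t * x j)))))\<^sup>2 +
    (1 - t\<^sup>2) * (\<Sum>j\<in>J. a j / (1 - t * x j))\<^sup>2"
proof -
  have pos: "1 - y * z \<noteq> 0" if "\<bar>y\<bar> < 1" "\<bar>z\<bar> < 1" for y z :: real
    using abs_mult_less[OF that] by (auto simp flip: abs_mult)
  have key: "a * b / (1 - y * z) = (a * ((y - t) / (1 - t * y))) * (b * ((z - t) / (1 - t * z))) / (1 - y * z)
      + (1 - t\<^sup>2) * ((a / (1 - t * y)) * (b / (1 - t * z)))"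
    if "\<bar>y\<bar> < 1" "\<bar>z\<bar> < 1" for a b y z :: real
  proof -
    have "1 / (1 - y * z) - ((y - t) / (1 - t * y)) * ((z - t) / (1 - t * z)) / (1 - y * z)
       = (1 - t\<^sup>2) / ((1 - t * y) * (1 - t * z))"
      using pos[OF that] pos[OF t that(1)] pos[OF t that(2)]
      by (simp add: divide_simps) (simp add: power2_eq_square algebra_simps)
    then have "1 / (1 - y * z) = ((y - t) / (1 - t * y)) * ((z - t) / (1 - t * z)) / (1 - y * z)
       + (1 - t\<^sup>2) / ((1 - t * y) * (1 - t * z))" by linarith
    from arg_cong[OF this, of "\<lambda>r. a * b * r"] show ?thesis
      by (simp add: algebra_simps)
  qed
  have norm_expand: "(norm (geom_sum x J c))\<^sup>2 = (\<Sum>i\<in>J. \<Sum>j\<in>J. c i * c j / (1 - x i * x j))" for c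
    using x by (rule norm_geom_sum_power2)
  have square: "(\<Sum>j\<in>J. a j / (1 - t * x j))\<^sup>2
      = (\<Sum>i\<in>J. \<Sum>j\<in>J. (a i / (1 - t * x i)) * (a j / (1 - t * x j)))"
    by (simp only: power2_eq_square sum_product)
  show ?thesis
    unfolding norm_expand square sum_distrib_left sum.distrib[symmetric]
    by (intro sum.cong refl key x)
qed

text \<open>
  Multiplying the coefficient at \<open>x j\<close> by \<open>1 - x j\<close> is the operator \<open>1 - T\<close>, where \<open>T\<close> is the backward
  shift, so this is a discrete analogue of Newman's inequality for exponential sums. One node \<open>t\<close> is
  removed at a time with the Blaschke factor at \<open>t\<close>. That multiplication commutes with \<open>1 - T\<close>, and
  the rank one defect contributes at most \<open>4 (1 - t) / t\<^sup>2\<close> times the squared norm of the sum.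
\<close>
lemma norm_geom_sum_nodes_diff_le:
  fixes x :: "'i \<Rightarrow> real"
  assumes "finite J" "\<And>j. j \<in> J \<Longrightarrow> 0 < x j \<and> x j < 1"
  shows "(norm (geom_sum x J (\<lambda>j. a j * (1 - x j))))\<^sup>2
    \<le> (\<Sum>j\<in>J. 4 * (1 - x j) / (x j)\<^sup>2) * (norm (geom_sum x J a))\<^sup>2"
  using assms
proof (induction J arbitrary: a rule: finite_induct)
  case empty
  then show ?case by (simp add: geom_sum_def)
next
  case (insert k J)
  define K t Q where "K = insert k J" and "t = x k" and "Q = (norm (geom_sum x (insert k J) a))\<^sup>2"
  have t: "0 < t" "t < 1" and x: "\<And>j. j \<in> K \<Longrightarrow> 0 < x j \<and> x j < 1"
    using insert.prems by (auto simp: t_def K_def)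
  have abs_x: "\<bar>x j\<bar> < 1" if "j \<in> K" for j
    using x[OF that] by simp
  have t_abs: "\<bar>t\<bar> < 1" using t by simp
  define b where "b = (\<lambda>c j. c j * ((x j - t) / (1 - t * x j)))"
  have drop_k: "geom_sum x K (b c) = geom_sum x J (b c)" for c
    using insert.hyps by (simp add: K_def geom_sum_def b_def t_def)
  have Blaschke: "(norm (geom_sum x K c))\<^sup>2 = (norm (geom_sum x J (b c)))\<^sup>2 +
      (1 - t\<^sup>2) * (\<Sum>j\<in>K. c j / (1 - t * x j))\<^sup>2" for c
    using norm_geom_sum_Blaschke[of K x t c] abs_x t_abs
    unfolding drop_k[symmetric] unfolding b_def by simp
  define A B where "A = (\<Sum>j\<in>K. a j)" and "B = (\<Sum>j\<in>K. a j / (1 - t * x j))"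
  have t2: "0 \<le> 1 - t\<^sup>2" using t by (simp add: power_le_one)
  have J_le: "(norm (geom_sum x J (b a)))\<^sup>2 \<le> Q" and B_le: "(1 - t\<^sup>2) * B\<^sup>2 \<le> Q"
    using Blaschke[of a] t2 by (simp_all add: Q_def B_def K_def)
  have A_le: "A\<^sup>2 \<le> Q"
    using norm_geom_sum_Blaschke[of K x 0 a] abs_x by (simp add: Q_def A_def K_def)
  have main: "(norm (geom_sum x J (b (\<lambda>j. a j * (1 - x j)))))\<^sup>2
      \<le> (\<Sum>j\<in>J. 4 * (1 - x j) / (x j)\<^sup>2) * Q"
  proof -
    have "b (\<lambda>j. a j * (1 - x j)) = (\<lambda>j. b a j * (1 - x j))"
      by (simp add: b_def fun_eq_iff)
    then have "(norm (geom_sum x J (b (\<lambda>j. a j * (1 - x j)))))\<^sup>2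
        \<le> (\<Sum>j\<in>J. 4 * (1 - x j) / (x j)\<^sup>2) * (norm (geom_sum x J (b a)))\<^sup>2"
      using insert.IH[of "b a"] insert.prems by simp
    also have "\<dots> \<le> (\<Sum>j\<in>J. 4 * (1 - x j) / (x j)\<^sup>2) * Q"
      using J_le insert.prems by (intro mult_left_mono sum_nonneg) (auto intro!: divide_nonneg_nonneg simp: less_imp_le)
    finally show ?thesis .
  qed
  \<comment> \<open>The defect functional of the differenced sum is a combination of \<open>A\<close>, the value of the sum at
    index zero, and \<open>B\<close>, its own defect functional with a factor \<open>1 - t\<close>.\<close>
  have "t * (\<Sum>j\<in>K. a j * (1 - x j) / (1 - t * x j)) = A - (1 - t) * B"
    unfolding A_def B_def sum_distrib_left sum_subtractf[symmetric]
  proof (rule sum.cong)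
    fix j assume "j \<in> K"
    then have "1 - t * x j \<noteq> 0"
      using x[of j] t mult_strict_mono[of t 1 "x j" 1] by auto
    then show "t * (a j * (1 - x j) / (1 - t * x j)) = a j - (1 - t) * (a j / (1 - t * x j))"
      by (simp add: divide_simps) (simp add: algebra_simps)
  qed simp
  then have rank_one: "t\<^sup>2 * (\<Sum>j\<in>K. a j * (1 - x j) / (1 - t * x j))\<^sup>2 = (A - (1 - t) * B)\<^sup>2"
    by (simp flip: power_mult_distrib)
  have "t\<^sup>2 * ((1 - t\<^sup>2) * (\<Sum>j\<in>K. a j * (1 - x j) / (1 - t * x j))\<^sup>2) = (1 - t\<^sup>2) * (A - (1 - t) * B)\<^sup>2"
    using rank_one by simp
  also have "\<dots> \<le> (1 - t\<^sup>2) * (2 * A\<^sup>2 + 2 * ((1 - t)\<^sup>2 * B\<^sup>2))"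
    using zero_le_power2[of "A + (1 - t) * B"]
    unfolding power2_sum power2_diff[of A] power_mult_distrib[symmetric]
    by (intro mult_left_mono t2) linarith
  also have "\<dots> = 2 * (1 - t\<^sup>2) * A\<^sup>2 + 2 * (1 - t)\<^sup>2 * ((1 - t\<^sup>2) * B\<^sup>2)"
    by (simp add: algebra_simps)
  also have "\<dots> \<le> 2 * (1 - t\<^sup>2) * Q + 2 * (1 - t)\<^sup>2 * Q"
    using A_le B_le t2 by (intro add_mono mult_left_mono) auto
  also have "\<dots> = 4 * (1 - t) * Q"
    by (simp add: power2_eq_square algebra_simps)
  finally have "(1 - t\<^sup>2) * (\<Sum>j\<in>K. a j * (1 - x j) / (1 - t * x j))\<^sup>2 \<le> 4 * (1 - t) / t\<^sup>2 * Q"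
    using t by (simp add: field_simps)
  with main Blaschke[of "\<lambda>j. a j * (1 - x j)"]
  have "(norm (geom_sum x K (\<lambda>j. a j * (1 - x j))))\<^sup>2
      \<le> (\<Sum>j\<in>J. 4 * (1 - x j) / (x j)\<^sup>2) * Q + 4 * (1 - t) / t\<^sup>2 * Q"
    by simp
  then show ?case
    using insert.hyps by (simp add: K_def Q_def t_def distrib_right add.commute)
qed

lemma norm_geom_sum_nodes_diff_power_le:
  fixes x :: "'i \<Rightarrow> real"
  assumes J: "finite J" "\<And>j. j \<in> J \<Longrightarrow> 0 < x j \<and> x j < 1"
    and small: "(\<Sum>j\<in>J. 4 * (1 - x j) / (x j)\<^sup>2) \<le> 1 / 4"
  shows "norm (geom_sum x J (\<lambda>j. a j * (1 - x j) ^ k)) \<le> (1 / 2) ^ k * norm (geom_sum x J a)"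
proof (induction k)
  case (Suc k)
  let ?F = "\<lambda>k. norm (geom_sum x J (\<lambda>j. a j * (1 - x j) ^ k))"
  have "?F (Suc k) \<le> 1 / 2 * ?F k"
  proof (rule power2_le_imp_le)
    have "(?F (Suc k))\<^sup>2 \<le> (\<Sum>j\<in>J. 4 * (1 - x j) / (x j)\<^sup>2) * (?F k)\<^sup>2"
      using norm_geom_sum_nodes_diff_le[of J x "\<lambda>j. a j * (1 - x j) ^ k"] J by (simp add: mult_ac)
    also have "\<dots> \<le> 1 / 4 * (?F k)\<^sup>2"
      by (intro mult_right_mono small) simp
    finally show "(?F (Suc k))\<^sup>2 \<le> (1 / 2 * ?F k)\<^sup>2"
      by (simp add: power_mult_distrib power_divide)
  qed simp
  with Suc.IH show ?case by simp
qed simp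

section \<open>Raising nodes close to one to a power\<close>

lemma abs_gchoose_le_1:
  assumes "0 \<le> r" "r \<le> (1::real)"
  shows "\<bar>r gchoose k\<bar> \<le> 1"
proof (induction k)
  case (Suc k)
  have "r gchoose Suc k = (r gchoose k) * ((r - real k) / real (Suc k))"
    using gbinomial_mult_1[of r k] by (simp add: field_simps)
  moreover have "\<bar>(r - real k) / real (Suc k)\<bar> \<le> 1"
    using assms by (simp add: abs_le_iff divide_simps)
  ultimately show ?case
    using mult_mono[OF Suc.IH, of "\<bar>(r - real k) / real (Suc k)\<bar>" 1] by (simp add: abs_mult)
qed simp

text \<open>
  The integers \<open>n\<close> with \<open>p n\<close> in \<open>[q, q + 1)\<close> lie in an interval of length less than \<open>1 / p\<close>.
\<close>
lemma card_floor_fibre_le: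
  assumes "p > (0::real)" "finite A"
  shows "card {n \<in> A. nat \<lfloor>p * real n\<rfloor> = q} \<le> nat \<lceil>1 / p\<rceil>"
proof (cases "{n \<in> A. nat \<lfloor>p * real n\<rfloor> = q} = {}")
  case False
  let ?S = "{n \<in> A. nat \<lfloor>p * real n\<rfloor> = q}"
  have S: "real q \<le> p * real n \<and> p * real n < real q + 1" if "n \<in> ?S" for n
  proof -
    have "\<lfloor>p * real n\<rfloor> = int q" using that \<open>p > 0\<close> by auto
    then show ?thesis by (simp add: floor_eq_iff)
  qed
  define n0 where "n0 = Min ?S"
  have n0: "n0 \<in> ?S" unfolding n0_def using False assms by (intro Min_in) auto
  have "n \<in> {n0..<n0 + nat \<lceil>1 / p\<rceil>}" if "n \<in> ?S" for n
  proof -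
    have "n0 \<le> n" unfolding n0_def using that assms by (intro Min_le) auto
    moreover have "p * real n - p * real n0 < 1"
      using S[OF that] S[OF n0] by linarith
    then have "real n - real n0 < 1 / p"
      using \<open>p > 0\<close> by (simp add: field_simps)
    then have "real n < real n0 + real_of_int \<lceil>1 / p\<rceil>"
      using le_of_int_ceiling[of "1 / p"] by linarith
    then have "int n < int n0 + \<lceil>1 / p\<rceil>" by linarith
    ultimately show ?thesis by auto
  qed
  then have "card ?S \<le> card {n0..<n0 + nat \<lceil>1 / p\<rceil>}"
    by (intro card_mono) auto
  then show ?thesis by simp
qed (simp only: card.empty)

lemma sum_coord_floor_square_le:
  assumes "p > (0::real)"
  shows "(\<Sum>n<N. (coord F (nat \<lfloor>p * real n\<rfloor>))\<^sup>2) \<le> real (nat \<lceil>1 / p\<rceil>) * (norm F)\<^sup>2"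
proof -
  let ?m = "\<lambda>n. nat \<lfloor>p * real n\<rfloor>"
  have "(\<Sum>n<N. (coord F (?m n))\<^sup>2)
      = (\<Sum>q\<in>?m ` {..<N}. \<Sum>n\<in>{n \<in> {..<N}. ?m n = q}. (coord F (?m n))\<^sup>2)"
    by (rule sum.image_gen) simp
  also have "\<dots> = (\<Sum>q\<in>?m ` {..<N}. real (card {n \<in> {..<N}. ?m n = q}) * (coord F q)\<^sup>2)"
    by (intro sum.cong refl) simp
  also have "\<dots> \<le> (\<Sum>q\<in>?m ` {..<N}. real (nat \<lceil>1 / p\<rceil>) * (coord F q)\<^sup>2)"
    using card_floor_fibre_le[OF assms, of "{..<N}"]
    by (intro sum_mono mult_right_mono) auto
  also have "\<dots> \<le> real (nat \<lceil>1 / p\<rceil>) * (norm F)\<^sup>2"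
    unfolding sum_distrib_left[symmetric]
    by (intro mult_left_mono sum_coord_square_le) auto
  finally show ?thesis .
qed

lemma L2_set_sum_le:
  "finite K \<Longrightarrow> L2_set (\<lambda>n. \<Sum>k\<in>K. f k n) A \<le> (\<Sum>k\<in>K. L2_set (f k) A)"
proof (induction K rule: finite_induct)
  case (insert k K)
  then show ?case
    using L2_set_triangle_ineq[of "f k" "\<lambda>n. \<Sum>k\<in>K. f k n" A] by simp
qed (simp add: L2_set_def)

text \<open>
  The entry of index \<open>n\<close> on the left is the exponential sum at \<open>p n = m + r\<close> with \<open>m\<close> an integer and
  \<open>0 \<le> r < 1\<close>. Expanding \<open>x\<^sup>r = (1 + (x - 1))\<^sup>r\<close> expresses it by the \<open>k\<close>-th differences of
  the sum at \<open>m\<close>. Their norms decay like \<open>2\<^sup>-\<^sup>k\<close>, the binomial coefficients are bounded by one, and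
  each \<open>m\<close> is hit at most \<open>\<lceil>1 / p\<rceil>\<close> times.
\<close>
lemma norm_geom_sum_powr_le_of_small:
  fixes x :: "'i \<Rightarrow> real"
  assumes J: "finite J" "\<And>j. j \<in> J \<Longrightarrow> 0 < x j \<and> x j < 1"
    and small: "(\<Sum>j\<in>J. 4 * (1 - x j) / (x j)\<^sup>2) \<le> 1 / 4"
    and p: "p > 0"
  shows "norm (geom_sum (\<lambda>j. x j powr p) J a)
    \<le> 2 * sqrt (real (nat \<lceil>1 / p\<rceil>)) * norm (geom_sum x J a)"
proof (rule norm_ell2_le)
  fix N
  let ?m = "\<lambda>n. nat \<lfloor>p * real n\<rfloor>" and ?r = "\<lambda>n. frac (p * real n)"
  define F where "F = (\<lambda>k. geom_sum x J (\<lambda>j. a j * (1 - x j) ^ k))"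
  define G where "G = geom_sum (\<lambda>j. x j powr p) J a"
  define L where "L = sqrt (real (nat \<lceil>1 / p\<rceil>))"
  define T where "T = (\<lambda>k n. (-1) ^ k * (?r n gchoose k) * coord (F k) (?m n))"
  have abs_x: "\<bar>x j\<bar> < 1" if "j \<in> J" for j
    using J(2)[OF that] by simp
  have powr_lt: "x j powr p < 1" if "j \<in> J" for j
    using J(2)[OF that] p powr_less_mono2[of p "x j" 1] by simp
  have expansion: "(\<lambda>k. T k n) sums coord G n" for n
  proof -
    have term_sums: "(\<lambda>k. a j * x j ^ ?m n * ((?r n gchoose k) * (x j - 1) ^ k)) sums (a j * (x j powr p) ^ n)"
      if "j \<in> J" for j
    proof -
      have xj: "0 < x j" "x j < 1" using J(2)[OF that] by auto
      have "(\<lambda>k. (?r n gchoose k) * (x j - 1) ^ k) sums (1 + (x j - 1)) powr ?r n"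
        using xj by (intro gen_binomial_real) simp
      then have "(\<lambda>k. a j * x j ^ ?m n * ((?r n gchoose k) * (x j - 1) ^ k)) sums
          (a j * x j ^ ?m n * x j powr ?r n)"
        by (intro sums_mult) simp
      moreover have "x j ^ ?m n * x j powr ?r n = (x j powr p) ^ n"
      proof -
        have "real (?m n) + ?r n = p * real n"
          using p by (simp add: frac_def)
        then have "x j powr real (?m n) * x j powr ?r n = x j powr (p * real n)"
          by (simp flip: powr_add)
        then show ?thesis
          using xj by (simp add: powr_realpow flip: powr_powr)
      qed
      ultimately show ?thesis by (simp add: mult.assoc)
    qed
    have "(\<lambda>k. \<Sum>j\<in>J. a j * x j ^ ?m n * ((?r n gchoose k) * (x j - 1) ^ k))
        sums (\<Sum>j\<in>J. a j * (x j powr p) ^ n)"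
      by (intro sums_sum term_sums)
    moreover have "coord G n = (\<Sum>j\<in>J. a j * (x j powr p) ^ n)"
      unfolding G_def geom_sum_def coord_sum
      using powr_lt by (intro sum.cong) auto
    moreover have "(\<Sum>j\<in>J. a j * x j ^ ?m n * ((?r n gchoose k) * (x j - 1) ^ k)) = T k n" for k
    proof -
      have "(x j - 1) ^ k = (-1) ^ k * (1 - x j) ^ k" for j
        by (simp flip: power_mult_distrib)
      then show ?thesis
        unfolding T_def F_def geom_sum_def coord_sum sum_distrib_left
        using abs_x by (intro sum.cong) (auto simp: mult_ac)
    qed
    ultimately show ?thesis by simp
  qed
  have T_le: "L2_set (T k) {..<N} \<le> (1 / 2) ^ k * (L * norm (F 0))" for k
  proof -
    have "L2_set (T k) {..<N} \<le> L2_set (\<lambda>n. \<bar>coord (F k) (?m n)\<bar>) {..<N}"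
    proof -
      have "\<bar>T k n\<bar> \<le> \<bar>coord (F k) (?m n)\<bar>" for n
        using mult_right_mono[OF abs_gchoose_le_1[of "?r n" k], of "\<bar>coord (F k) (?m n)\<bar>"]
        by (simp add: T_def abs_mult frac_lt_1 less_imp_le)
      then show ?thesis
        using L2_set_mono[of "{..<N}" "\<lambda>n. \<bar>T k n\<bar>" "\<lambda>n. \<bar>coord (F k) (?m n)\<bar>"]
        by (simp add: L2_set_def)
    qed
    also have "\<dots> \<le> sqrt (real (nat \<lceil>1 / p\<rceil>) * (norm (F k))\<^sup>2)"
      unfolding L2_set_def power2_abs
      by (intro real_sqrt_le_mono sum_coord_floor_square_le p)
    also have "\<dots> = L * norm (F k)"
      by (simp add: L_def real_sqrt_mult)
    also have "\<dots> \<le> L * ((1 / 2) ^ k * norm (F 0))"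
      using norm_geom_sum_nodes_diff_power_le[of J x a k] J small
      by (intro mult_left_mono) (simp_all add: F_def L_def)
    finally show ?thesis by (simp add: mult_ac)
  qed
  have partial: "L2_set (\<lambda>n. \<Sum>k<R. T k n) {..<N} \<le> 2 * L * norm (F 0)" for R
  proof -
    have "L2_set (\<lambda>n. \<Sum>k<R. T k n) {..<N} \<le> (\<Sum>k<R. L2_set (T k) {..<N})"
      by (rule L2_set_sum_le) simp
    also have "\<dots> \<le> (\<Sum>k<R. (1 / 2) ^ k * (L * norm (F 0)))"
      by (intro sum_mono T_le)
    also have "\<dots> = (\<Sum>k<R. (1 / 2) ^ k) * (L * norm (F 0))"
      by (simp add: sum_distrib_right)
    also have "\<dots> \<le> 2 * (L * norm (F 0))"
      unfolding sum_gp_strict by (intro mult_right_mono) (auto simp: L_def)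
    finally show ?thesis by simp
  qed
  \<comment> \<open>Only finitely many indices \<open>n\<close> are involved, so the bound for the partial sums of the binomial
    series passes to the limit.\<close>
  have "L2_set (coord G) {..<N} \<le> 2 * L * norm (F 0)"
  proof (rule LIMSEQ_le_const2)
    show "(\<lambda>R. L2_set (\<lambda>n. \<Sum>k<R. T k n) {..<N}) \<longlonglongrightarrow> L2_set (coord G) {..<N}"
      unfolding L2_set_def
      using expansion by (intro tendsto_real_sqrt tendsto_sum tendsto_power) (simp add: sums_def)
    show "\<exists>R. \<forall>R'\<ge>R. L2_set (\<lambda>n. \<Sum>k<R'. T k n) {..<N} \<le> 2 * L * norm (F 0)"
      using partial by blast
  qed
  then have "(L2_set (coord G) {..<N})\<^sup>2 \<le> (2 * L * norm (F 0))\<^sup>2"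
    by (intro power_mono) auto
  then show "(\<Sum>n<N. (coord (geom_sum (\<lambda>j. x j powr p) J a) n)\<^sup>2)
      \<le> (2 * sqrt (real (nat \<lceil>1 / p\<rceil>)) * norm (geom_sum x J a))\<^sup>2"
    by (simp add: L2_set_def G_def F_def L_def sum_nonneg)
qed simp

section \<open>Nodes satisfying the Blaschke condition\<close>

lemma summable_imp_small_finite_tail_sums:
  fixes f :: "nat \<Rightarrow> real"
  assumes "summable f" "\<And>n. 0 \<le> f n" "e > 0"
  shows "\<exists>M. \<forall>J. finite J \<longrightarrow> J \<subseteq> {M..} \<longrightarrow> sum f J \<le> e"
proof -
  from assms obtain M where M: "\<And>m n. m \<ge> M \<Longrightarrow> norm (sum f {m..<n}) < e"
    unfolding summable_Cauchy by blast
  have "sum f J \<le> e" if J: "finite J" "J \<subseteq> {M..}" for J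
  proof -
    have "J \<subseteq> {M..<Suc (Max J)}"
      using J by (auto simp: less_Suc_eq_le)
    then have "sum f J \<le> sum f {M..<Suc (Max J)}"
      using assms by (intro sum_mono2) auto
    also have "\<dots> < e"
      using M[of M "Suc (Max J)"] by simp
    finally show ?thesis by simp
  qed
  then show ?thesis by blast
qed

text \<open>
  This is the Weierstrass product inequality.
\<close>
lemma prod_ge_one_minus_sum:
  fixes e :: "'i \<Rightarrow> real"
  assumes "finite J" "\<And>j. j \<in> J \<Longrightarrow> 0 \<le> e j \<and> e j \<le> 1"
  shows "1 - (\<Sum>j\<in>J. 1 - e j) \<le> prod e J"
  using assms
proof (induction J rule: finite_induct)
  case (insert i J)
  have "0 \<le> prod e J" "prod e J \<le> 1"
    using insert.prems by (auto intro!: prod_nonneg prod_le_1)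
  then have "(1 - e i) * prod e J \<le> (1 - e i) * 1"
    using insert.prems by (intro mult_left_mono) auto
  then show ?case
    using insert by (simp add: algebra_simps)
qed simp

text \<open>
  One minus the square of the pseudohyperbolic distance from \<open>x j\<close> to \<open>y\<close> is at most a constant
  times \<open>1 - x j\<close>. Hence the factors of large index multiply to at least one half, whichever of them
  are taken, and the finitely many others are positive.
\<close>
lemma finite_Blaschke_products_bounded_below:
  fixes x :: "nat \<Rightarrow> real"
  assumes x: "\<And>j. 0 \<le> x j \<and> x j < 1" and summable: "summable (\<lambda>j. 1 - x j)"
    and y: "0 \<le> y" "y < 1" and distinct: "\<And>j. j \<ge> N \<Longrightarrow> x j \<noteq> y"
  shows "\<exists>c>0. \<forall>J. finite J \<longrightarrow> J \<subseteq> {N..} \<longrightarrow>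
    c \<le> (\<Prod>j\<in>J. ((y - x j) / (1 - x j * y))\<^sup>2)"
proof -
  define e where "e = (\<lambda>j. ((y - x j) / (1 - x j * y))\<^sup>2)"
  have denom: "1 - y \<le> 1 - x j * y" for j
    using x[of j] y mult_right_mono[of "x j" 1 y] by simp
  have one_minus_e: "1 - e j = (1 - (x j)\<^sup>2) * (1 - y\<^sup>2) / (1 - x j * y)\<^sup>2" for j
  proof -
    have "1 - x j * y \<noteq> 0" using denom[of j] y by linarith
    then show ?thesis
      by (simp add: e_def power_divide divide_simps) (simp add: power2_eq_square algebra_simps)
  qed
  have e_le: "e j \<le> 1" for j
  proof -
    have "0 \<le> (1 - (x j)\<^sup>2) * (1 - y\<^sup>2) / (1 - x j * y)\<^sup>2"
      using x[of j] y by (intro divide_nonneg_nonneg mult_nonneg_nonneg) (simp_all add: power_le_one)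
    then show ?thesis using one_minus_e[of j] by linarith
  qed
  have e_ge: "0 \<le> e j" for j by (simp add: e_def)
  have e_pos: "0 < e j" if "j \<ge> N" for j
    using distinct[OF that] denom[of j] y by (simp add: e_def)
  have y2: "1 - y\<^sup>2 \<le> 2" "0 \<le> 1 - y\<^sup>2"
    using power_le_one[of y 2] zero_le_power2[of y] y by linarith+
  have deficit: "1 - e j \<le> 4 / (1 - y)\<^sup>2 * (1 - x j)" for j
  proof -
    have "1 - (x j)\<^sup>2 = (1 - x j) * (1 + x j)" by (simp add: power2_eq_square algebra_simps)
    also have "\<dots> \<le> (1 - x j) * 2" using x[of j] by (intro mult_left_mono) auto
    finally have "(1 - (x j)\<^sup>2) * (1 - y\<^sup>2) \<le> ((1 - x j) * 2) * 2"
      using x[of j] y2 by (intro mult_mono) auto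
    moreover have "(1 - y)\<^sup>2 \<le> (1 - x j * y)\<^sup>2"
      using denom[of j] y by (intro power_mono) auto
    ultimately have "1 - e j \<le> ((1 - x j) * 2) * 2 / (1 - y)\<^sup>2"
      unfolding one_minus_e using x[of j] y by (intro frac_le) auto
    then show ?thesis by simp
  qed
  have nonneg: "0 \<le> 4 / (1 - y)\<^sup>2 * (1 - x j)" for j
    using x[of j] by simp
  have "summable (\<lambda>j. 4 / (1 - y)\<^sup>2 * (1 - x j))"
    by (intro summable_mult summable)
  then obtain M where M: "\<And>J. finite J \<Longrightarrow> J \<subseteq> {M..} \<Longrightarrow> (\<Sum>j\<in>J. 4 / (1 - y)\<^sup>2 * (1 - x j)) \<le> 1 / 2"
    using summable_imp_small_finite_tail_sums[of "\<lambda>j. 4 / (1 - y)\<^sup>2 * (1 - x j)" "1 / 2"]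
      nonneg by auto
  define c where "c = prod e {N..<M} * (1 / 2)"
  have "c > 0"
    unfolding c_def using e_pos by (intro mult_pos_pos prod_pos) auto
  moreover have "c \<le> prod e J" if J: "finite J" "J \<subseteq> {N..}" for J
  proof -
    define J1 J2 where "J1 = J \<inter> {N..<M}" and "J2 = J \<inter> {M..}"
    have "prod e {N..<M} = prod e J1 * prod e ({N..<M} - J1)"
      unfolding J1_def by (subst prod.union_disjoint[symmetric]) (auto intro!: prod.cong)
    also have "\<dots> \<le> prod e J1 * 1"
      by (intro mult_left_mono prod_le_1 prod_nonneg) (auto simp: e_ge e_le)
    finally have head: "prod e {N..<M} \<le> prod e J1" by simp
    have J2: "finite J2" "J2 \<subseteq> {M..}" using J by (auto simp: J2_def)
    have "(\<Sum>j\<in>J2. 1 - e j) \<le> (\<Sum>j\<in>J2. 4 / (1 - y)\<^sup>2 * (1 - x j))"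
      by (intro sum_mono deficit)
    with M[OF J2] have "1 / 2 \<le> 1 - (\<Sum>j\<in>J2. 1 - e j)" by linarith
    also have "\<dots> \<le> prod e J2"
      by (intro prod_ge_one_minus_sum J2) (auto simp: e_ge e_le)
    finally have "c \<le> prod e J1 * prod e J2"
      unfolding c_def using head by (intro mult_mono prod_nonneg) (auto simp: e_ge)
    also have "\<dots> = prod e J"
      using J by (subst prod.union_disjoint[symmetric]) (auto simp: J1_def J2_def intro!: prod.cong)
    finally show ?thesis .
  qed
  ultimately show ?thesis unfolding e_def by blast
qed

text \<open>
  Applying the Blaschke contractions at all nodes other than \<open>x k\<close> leaves a multiple of a single
  geometric sequence, which has norm at least one.
\<close>
lemma coefficient_le_norm_geom_sum:
  assumes "finite J" "k \<notin> J" "\<And>j. j \<in> insert k J \<Longrightarrow> \<bar>x j\<bar> < 1"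
  shows "(a k)\<^sup>2 * (\<Prod>j\<in>J. ((x k - x j) / (1 - x j * x k))\<^sup>2)
    \<le> (norm (geom_sum x (insert k J) a))\<^sup>2"
  using assms
proof (induction J arbitrary: a rule: finite_induct)
  case empty
  then have "(x k)\<^sup>2 < 1" by (simp add: abs_square_less_1)
  then have "1 \<le> 1 / (1 - (x k)\<^sup>2)" by simp
  moreover have "(norm (geom (x k)))\<^sup>2 = 1 / (1 - (x k)\<^sup>2)"
    unfolding power2_norm_eq_inner power2_eq_square[of "x k"] using empty by (intro inner_geom) auto
  ultimately have "1 \<le> (norm (geom (x k)))\<^sup>2" by simp
  then show ?case
    using mult_left_mono[of 1 "(norm (geom (x k)))\<^sup>2" "(a k)\<^sup>2"]
    by (simp add: geom_sum_def power_mult_distrib)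
next
  case (insert i J)
  let ?K = "insert k (insert i J)"
  define b where "b = (\<lambda>j. a j * ((x j - x i) / (1 - x i * x j)))"
  have "(a k)\<^sup>2 * (\<Prod>j\<in>insert i J. ((x k - x j) / (1 - x j * x k))\<^sup>2)
      = (b k)\<^sup>2 * (\<Prod>j\<in>J. ((x k - x j) / (1 - x j * x k))\<^sup>2)"
    using insert.hyps by (simp add: b_def power_mult_distrib power_divide)
  also have "\<dots> \<le> (norm (geom_sum x (insert k J) b))\<^sup>2"
    using insert by (intro insert.IH) auto
  also have "geom_sum x (insert k J) b = geom_sum x ?K b"
    using insert by (simp add: geom_sum_def b_def)
  also have "(norm (geom_sum x ?K b))\<^sup>2 \<le> (norm (geom_sum x ?K a))\<^sup>2"
  proof -
    have "(x i)\<^sup>2 < 1" using insert.prems(2)[of i] by (simp add: abs_square_less_1)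
    moreover have "(norm (geom_sum x ?K a))\<^sup>2 = (norm (geom_sum x ?K b))\<^sup>2
        + (1 - (x i)\<^sup>2) * (\<Sum>j\<in>?K. a j / (1 - x i * x j))\<^sup>2"
      unfolding b_def using insert.prems(2) by (intro norm_geom_sum_Blaschke) auto
    ultimately show ?thesis by simp
  qed
  finally show ?case .
qed

text \<open>
  The nodes from some index on lie close enough to one for the binomial expansion. The finitely many
  earlier ones are then added by downward induction on the first index: the new coefficient is
  bounded by the norm of the whole sum, so the new term can be split off on both sides.
\<close>
lemma norm_geom_sum_powr_le:
  fixes x :: "nat \<Rightarrow> real"
  assumes x: "\<And>j. 0 \<le> x j \<and> x j < 1" and inj: "inj x"
    and summable: "summable (\<lambda>j. 1 - x j)" and p: "p > 0"
  shows "\<exists>C. \<forall>J a. finite J \<longrightarrow>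
    norm (geom_sum (\<lambda>j. x j powr p) J a) \<le> C * norm (geom_sum x J a)"
proof -
  let ?P = "\<lambda>N. \<exists>C\<ge>0. \<forall>J a. finite J \<longrightarrow> J \<subseteq> {N..} \<longrightarrow>
    norm (geom_sum (\<lambda>j. x j powr p) J a) \<le> C * norm (geom_sum x J a)"
  have abs_x: "\<bar>x j\<bar> < 1" for j
    using x[of j] by simp
  have "0 \<le> 1 - x j" for j
    using x[of j] by simp
  then obtain N0 where N0: "\<And>J. finite J \<Longrightarrow> J \<subseteq> {N0..} \<Longrightarrow> (\<Sum>j\<in>J. 1 - x j) \<le> 1 / 64"
    using summable_imp_small_finite_tail_sums[OF summable, of "1 / 64"] by auto
  \<comment> \<open>The bound \<open>1 / 64\<close> on the tail sums forces \<open>x j \<ge> 1 / 2\<close>, and then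
    \<open>4 (1 - x j) / (x j)\<^sup>2 \<le> 16 (1 - x j)\<close> sums to at most \<open>1 / 4\<close>.\<close>
  have "?P N0"
  proof (intro exI conjI allI impI)
    fix J a assume J: "finite J" "J \<subseteq> {N0..}"
    have large: "1 / 2 \<le> x j" if "j \<in> J" for j
      using N0[of "{j}"] that J by auto
    have "(\<Sum>j\<in>J. 4 * (1 - x j) / (x j)\<^sup>2) \<le> (\<Sum>j\<in>J. 16 * (1 - x j))"
    proof (rule sum_mono)
      fix j assume "j \<in> J"
      have "(1 / 2)\<^sup>2 \<le> (x j)\<^sup>2" using large[OF \<open>j \<in> J\<close>] by (intro power_mono) auto
      then have "4 * (1 - x j) / (x j)\<^sup>2 \<le> 4 * (1 - x j) / (1 / 2)\<^sup>2"
        using x[of j] by (intro divide_left_mono) (auto simp: power2_eq_square)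
      then show "4 * (1 - x j) / (x j)\<^sup>2 \<le> 16 * (1 - x j)"
        by (simp add: power2_eq_square)
    qed
    also have "\<dots> \<le> 1 / 4"
      using N0[OF J] unfolding sum_distrib_left[symmetric] by linarith
    finally show "norm (geom_sum (\<lambda>j. x j powr p) J a)
        \<le> 2 * sqrt (real (nat \<lceil>1 / p\<rceil>)) * norm (geom_sum x J a)"
      using J(1) p x large by (intro norm_geom_sum_powr_le_of_small) force+
  qed simp
  then have "?P 0"
  proof (induction N0)
    case (Suc N)
    then obtain C where C: "C \<ge> 0" "\<And>J a. finite J \<Longrightarrow> J \<subseteq> {Suc N..} \<Longrightarrow>
        norm (geom_sum (\<lambda>j. x j powr p) J a) \<le> C * norm (geom_sum x J a)"
      by blast
    have "\<exists>c>0. \<forall>J. finite J \<longrightarrow> J \<subseteq> {Suc N..} \<longrightarrow>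
        c \<le> (\<Prod>j\<in>J. ((x N - x j) / (1 - x j * x N))\<^sup>2)"
      using x inj by (intro finite_Blaschke_products_bounded_below summable) (auto simp: inj_eq)
    then obtain c where c: "c > 0" "\<And>J. finite J \<Longrightarrow> J \<subseteq> {Suc N..} \<Longrightarrow>
        c \<le> (\<Prod>j\<in>J. ((x N - x j) / (1 - x j * x N))\<^sup>2)"
      by blast
    define g h where "g = norm (geom (x N powr p))" and "h = norm (geom (x N))"
    define D where "D = C + (g + C * h) / sqrt c"
    have gh: "g \<ge> 0" "h \<ge> 0" by (simp_all add: g_def h_def)
    have "D \<ge> C" using C(1) c(1) gh by (simp add: D_def)
    have "norm (geom_sum (\<lambda>j. x j powr p) J a) \<le> D * norm (geom_sum x J a)"
      if J: "finite J" "J \<subseteq> {N..}" for J a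
    proof (cases "N \<in> J")
      case False
      with J have "J \<subseteq> {Suc N..}" by (force simp: Suc_le_eq nat_less_le)
      then show ?thesis
        using C(2)[OF J(1)] \<open>D \<ge> C\<close> by (meson mult_right_mono norm_ge_zero order_trans)
    next
      case True
      define K where "K = J - {N}"
      have K: "finite K" "K \<subseteq> {Suc N..}" "N \<notin> K" "J = insert N K"
        using J True by (auto simp: K_def Suc_le_eq nat_less_le)
      let ?n = "norm (geom_sum x J a)"
      have "c * (a N)\<^sup>2 \<le> (\<Prod>j\<in>K. ((x N - x j) / (1 - x j * x N))\<^sup>2) * (a N)\<^sup>2"
        by (intro mult_right_mono c(2) K) simp
      also have "\<dots> \<le> ?n\<^sup>2"
        using coefficient_le_norm_geom_sum[OF K(1,3), of x a] abs_x
        by (simp add: mult.commute flip: K(4))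
      finally have "sqrt (c * (a N)\<^sup>2) \<le> ?n"
        by (intro real_le_lsqrt) (use c in auto)
      then have aN: "\<bar>a N\<bar> \<le> ?n / sqrt c"
        using c(1) by (simp add: real_sqrt_mult field_simps)
      have split: "geom_sum z J a = a N *\<^sub>R geom (z N) + geom_sum z K a" for z
        using K by (simp add: geom_sum_def)
      have "norm (geom_sum x K a) \<le> ?n + \<bar>a N\<bar> * h"
        using norm_triangle_ineq4[of "geom_sum x J a" "a N *\<^sub>R geom (x N)"]
        by (simp add: split h_def)
      then have tail: "norm (geom_sum (\<lambda>j. x j powr p) K a) \<le> C * (?n + \<bar>a N\<bar> * h)"
        using C(2)[OF K(1,2), of a] mult_left_mono[OF _ C(1)] by (meson order_trans)
      have "norm (geom_sum (\<lambda>j. x j powr p) J a) \<le> \<bar>a N\<bar> * g + norm (geom_sum (\<lambda>j. x j powr p) K a)"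
        unfolding split g_def by (rule order_trans[OF norm_triangle_ineq]) simp
      also have "\<dots> \<le> \<bar>a N\<bar> * g + C * (?n + \<bar>a N\<bar> * h)"
        using tail by simp
      also have "\<dots> = C * ?n + \<bar>a N\<bar> * (g + C * h)"
        by (simp add: algebra_simps)
      also have "\<dots> \<le> C * ?n + ?n / sqrt c * (g + C * h)"
        using C(1) gh by (intro add_left_mono mult_right_mono aN) auto
      also have "\<dots> = D * ?n"
        by (simp add: D_def algebra_simps)
      finally show ?thesis .
    qed
    with \<open>D \<ge> C\<close> C(1) have "?P N"
      by (intro exI[of _ D]) auto
    then show ?case by (rule Suc.IH)
  qed
  then show ?thesis by auto
qed

section \<open>Traces of the Hardy space on real nodes\<close>

lemma ell2_powr_interpolation:
  fixes x :: "nat \<Rightarrow> real"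
  assumes x: "\<And>j. 0 \<le> x j \<and> x j < 1" and "inj x"
    and "summable (\<lambda>j. 1 - x j)" and "p > 0"
  shows "\<exists>d. \<forall>j. inner d (geom (x j)) = inner f (geom (x j powr p))"
proof -
  obtain C where C: "\<And>J a. finite J \<Longrightarrow>
      norm (geom_sum (\<lambda>j. x j powr p) J a) \<le> C * norm (geom_sum x J a)"
    using norm_geom_sum_powr_le[OF assms] by blast
  show ?thesis
  proof (rule inner_interpolation_of_bounded_functional)
    fix J :: "nat set" and a
    assume "finite J"
    have "(\<Sum>j\<in>J. a j * inner f (geom (x j powr p))) = inner f (geom_sum (\<lambda>j. x j powr p) J a)"
      by (simp add: geom_sum_def inner_sum_right)
    also have "\<dots> \<le> norm f * norm (geom_sum (\<lambda>j. x j powr p) J a)"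
      by (rule norm_cauchy_schwarz)
    also have "\<dots> \<le> norm f * (C * norm (geom_sum x J a))"
      by (intro mult_left_mono C \<open>finite J\<close>) simp
    finally show "(\<Sum>j\<in>J. a j * inner f (geom (x j powr p)))
        \<le> (norm f * C) * norm (\<Sum>j\<in>J. a j *\<^sub>R geom (x j))"
      by (simp add: geom_sum_def mult.assoc)
  qed
qed

lemma hardy_H2_real_values:
  assumes "f \<in> hardy_H2"
  shows "\<exists>u v. \<forall>y. \<bar>y\<bar> < 1 \<longrightarrow> f (of_real y) = Complex (inner u (geom y)) (inner v (geom y))"
proof -
  from assms obtain c :: "nat \<Rightarrow> complex" where
    c: "\<forall>z\<in>ball 0 1. (\<lambda>n. c n * z ^ n) sums f z" "summable (\<lambda>n. (cmod (c n))\<^sup>2)"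
    unfolding hardy_H2_def by blast
  have "summable (\<lambda>n. (Re (c n))\<^sup>2)" "summable (\<lambda>n. (Im (c n))\<^sup>2)"
    by (rule summable_comparison_test'[OF c(2)]; simp add: cmod_power2)+
  then have coords: "coord (Ell2 (\<lambda>n. Re (c n))) = (\<lambda>n. Re (c n))" "coord (Ell2 (\<lambda>n. Im (c n))) = (\<lambda>n. Im (c n))"
    by (simp_all add: Ell2_inverse)
  have "f (of_real y) = Complex (inner (Ell2 (\<lambda>n. Re (c n))) (geom y)) (inner (Ell2 (\<lambda>n. Im (c n))) (geom y))"
    if y: "\<bar>y\<bar> < 1" for y
  proof -
    have "(\<lambda>n. c n * of_real (y ^ n)) sums f (of_real y)"
      using bspec[OF c(1), of "of_real y"] y by simp
    from sums_Re[OF this] sums_Im[OF this] show ?thesis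
      using inner_ell2_sums[of "Ell2 (\<lambda>n. Re (c n))" "geom y"]
        inner_ell2_sums[of "Ell2 (\<lambda>n. Im (c n))" "geom y"] y
      by (simp add: coords complex_eq_iff sums_iff)
  qed
  then show ?thesis by blast
qed

lemma hardy_H2_of_ell2:
  "\<exists>g\<in>hardy_H2. \<forall>y. \<bar>y\<bar> < 1 \<longrightarrow> g (of_real y) = Complex (inner u (geom y)) (inner v (geom y))"
proof -
  define c where "c = (\<lambda>n. Complex (coord u n) (coord v n))"
  define g where "g = (\<lambda>z. \<Sum>n. c n * z ^ n)"
  have c_le: "cmod (c n) \<le> norm u + norm v" for n
    using cmod_le[of "c n"] abs_coord_le_norm[of u n] abs_coord_le_norm[of v n]
    by (simp add: c_def)
  have sums: "(\<lambda>n. c n * z ^ n) sums g z" if "z \<in> ball 0 1" for z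
  proof -
    have "summable (\<lambda>n. c n * z ^ n)"
    proof (rule summable_comparison_test')
      show "summable (\<lambda>n. (norm u + norm v) * cmod z ^ n)"
        using that by (intro summable_mult summable_geometric) simp
      show "norm (c n * z ^ n) \<le> (norm u + norm v) * cmod z ^ n" for n
        using c_le[of n] by (simp add: norm_mult norm_power mult_right_mono)
    qed
    then show ?thesis unfolding g_def by (rule summable_sums)
  qed
  have "g holomorphic_on ball 0 1"
    by (rule power_series_holomorphic[of 0 1 c]) (use sums in simp)
  then have "g analytic_on ball 0 1"
    by (simp add: analytic_on_open)
  moreover have "summable (\<lambda>n. (cmod (c n))\<^sup>2)"
    using summable_add[OF summable_coord_square[of u] summable_coord_square[of v]]
    by (simp add: c_def cmod_power2)
  ultimately have "g \<in> hardy_H2"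
    using sums unfolding hardy_H2_def by blast
  moreover have "g (of_real y) = Complex (inner u (geom y)) (inner v (geom y))" if y: "\<bar>y\<bar> < 1" for y
  proof -
    have "(\<lambda>n. c n * of_real (y ^ n)) sums g (of_real y)"
      using sums[of "of_real y"] y by simp
    from sums_Re[OF this] sums_Im[OF this] show ?thesis
      using inner_ell2_sums[of u "geom y"] inner_ell2_sums[of v "geom y"] y
      by (simp add: c_def complex_eq_iff sums_iff)
  qed
  ultimately show ?thesis by blast
qed

text \<open>
  The nodes and their powers are real, so real and imaginary parts can be interpolated separately.
\<close>
lemma H2_trace_powr_subset:
  fixes x :: "nat \<Rightarrow> real"
  assumes x: "\<And>j. 0 \<le> x j \<and> x j < 1" and "inj x"
    and "summable (\<lambda>j. 1 - x j)" and p: "p > 0"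
  shows "H2_trace (\<lambda>j. of_real (x j powr p)) \<subseteq> H2_trace (\<lambda>j. of_real (x j))"
proof
  fix w assume "w \<in> H2_trace (\<lambda>j. of_real (x j powr p))"
  then obtain f where f: "f \<in> hardy_H2" and w: "w = (\<lambda>j. f (of_real (x j powr p)))"
    unfolding H2_trace_def by blast
  obtain u v where uv: "\<And>y. \<bar>y\<bar> < 1 \<Longrightarrow> f (of_real y) = Complex (inner u (geom y)) (inner v (geom y))"
    using hardy_H2_real_values[OF f] by blast
  obtain u' where u': "\<And>j. inner u' (geom (x j)) = inner u (geom (x j powr p))"
    using ell2_powr_interpolation[OF assms, of u] by blast
  obtain v' where v': "\<And>j. inner v' (geom (x j)) = inner v (geom (x j powr p))"
    using ell2_powr_interpolation[OF assms, of v] by blast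
  obtain g where g: "g \<in> hardy_H2"
    "\<And>y. \<bar>y\<bar> < 1 \<Longrightarrow> g (of_real y) = Complex (inner u' (geom y)) (inner v' (geom y))"
    using hardy_H2_of_ell2[of u' v'] by blast
  have "w j = g (of_real (x j))" for j
  proof -
    have "\<bar>x j\<bar> < 1" "\<bar>x j powr p\<bar> < 1"
      using x[of j] p powr_less_mono2[of p "x j" 1] by auto
    then show ?thesis by (simp only: w uv g(2) u' v')
  qed
  then show "w \<in> H2_trace (\<lambda>j. of_real (x j))"
    unfolding H2_trace_def using g(1) by blast
qed

section \<open>The Blaschke condition for finite unions of Carleson sequences\<close>

lemma one_minus_pseudohyp_dist_power2:
  assumes "cmod w < 1" "cmod z < 1"
  shows "1 - (pseudohyp_dist w z)\<^sup>2 = (1 - (cmod w)\<^sup>2) * (1 - (cmod z)\<^sup>2) / (cmod (1 - cnj w * z))\<^sup>2"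
proof -
  have "cmod (cnj w * z) < 1"
    using assms mult_strict_mono'[of "cmod w" 1 "cmod z" 1] by (simp add: norm_mult)
  then have "1 - cnj w * z \<noteq> 0" by auto
  moreover have "(cmod (1 - cnj w * z))\<^sup>2 - (cmod (w - z))\<^sup>2 = (1 - (cmod w)\<^sup>2) * (1 - (cmod z)\<^sup>2)"
    unfolding cmod_power2 by (simp add: power2_eq_square algebra_simps)
  ultimately show ?thesis
    by (simp add: pseudohyp_dist_def norm_divide power_divide field_simps)
qed

text \<open>
  The third bound turns summability of the deficits \<open>1 - \<rho>(w, z)\<close> for a fixed \<open>z\<close> into summability
  of the distances \<open>1 - |w|\<close> to the unit circle.
\<close>
lemma pseudohyp_dist_bounds:
  assumes "cmod w < 1" "cmod z < 1"
  shows "0 \<le> pseudohyp_dist w z" "pseudohyp_dist w z \<le> 1"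
    "(1 - (cmod z)\<^sup>2) * (1 - cmod w) \<le> 8 * (1 - pseudohyp_dist w z)"
proof -
  define r where "r = pseudohyp_dist w z"
  define D where "D = (cmod (1 - cnj w * z))\<^sup>2"
  have r: "1 - r\<^sup>2 = (1 - (cmod w)\<^sup>2) * (1 - (cmod z)\<^sup>2) / D"
    unfolding r_def D_def using assms by (rule one_minus_pseudohyp_dist_power2)
  have squares: "0 \<le> 1 - (cmod w)\<^sup>2" "0 \<le> 1 - (cmod z)\<^sup>2"
    using assms by (auto simp: power_le_one)
  show "0 \<le> pseudohyp_dist w z" by (simp add: pseudohyp_dist_def)
  have "0 \<le> 1 - r\<^sup>2"
    unfolding r D_def using squares by (intro divide_nonneg_nonneg mult_nonneg_nonneg) auto
  then show r1: "pseudohyp_dist w z \<le> 1"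
    using power2_le_imp_le[of r 1] by (simp add: r_def)
  have cwz: "cmod (cnj w * z) < 1"
    using assms mult_strict_mono'[of "cmod w" 1 "cmod z" 1] by (simp add: norm_mult)
  then have "1 - cnj w * z \<noteq> 0" by auto
  then have D0: "0 < D" by (simp add: D_def)
  have "cmod (1 - cnj w * z) \<le> 2"
    using norm_triangle_ineq4[of 1 "cnj w * z"] cwz by simp
  then have "D \<le> 2\<^sup>2" unfolding D_def by (intro power_mono) auto
  have "(1 - (cmod z)\<^sup>2) * (1 - cmod w) \<le> (1 - (cmod z)\<^sup>2) * (1 - (cmod w)\<^sup>2)"
    using assms by (intro mult_left_mono squares) (simp add: power2_eq_square mult_left_le)
  also have "\<dots> = (1 - r\<^sup>2) * D"
    using D0 by (simp add: r)
  also have "\<dots> \<le> (1 - r\<^sup>2) * 2\<^sup>2"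
    by (intro mult_left_mono) fact+
  also have "1 - r\<^sup>2 \<le> (1 - r) * 2"
    using zero_le_power2[of "1 - r"] by (simp add: power2_diff)
  finally show "(1 - (cmod z)\<^sup>2) * (1 - cmod w) \<le> 8 * (1 - pseudohyp_dist w z)"
    by (simp add: r_def)
qed

text \<open>
  The Carleson product at the index \<open>0\<close> is a positive lower bound for its partial products, and \<open>\<rho> \<le> exp (- (1 - \<rho>))\<close> turns this into an upper bound for the sum of the
  deficits \<open>1 - \<rho>\<close>.
\<close>
lemma carleson_seq_imp_Blaschke_condition:
  assumes "carleson_seq \<mu>"
  shows "summable (\<lambda>i. 1 - cmod (\<mu> i))"
proof -
  define P where "P = (\<lambda>j n. \<Prod>i\<in>{..<n} - {j}. pseudohyp_dist (\<mu> i) (\<mu> j))"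
  have \<mu>: "cmod (\<mu> i) < 1" for i
    using assms unfolding carleson_seq_def by (auto simp: image_subset_iff)
  have pos: "(INF j. lim (P j)) > 0"
    using assms unfolding carleson_seq_def P_def by blast
  have P_nonneg: "0 \<le> P j n" for j n
    unfolding P_def by (intro prod_nonneg pseudohyp_dist_bounds \<mu>)
  have P_decseq: "decseq (P j)" for j
  proof (rule decseq_SucI)
    fix n
    have "P j (Suc n) = (if n = j then 1 else pseudohyp_dist (\<mu> n) (\<mu> j)) * P j n"
      unfolding P_def lessThan_Suc by (auto simp: insert_Diff_if)
    also have "\<dots> \<le> 1 * P j n"
      by (intro mult_right_mono P_nonneg) (auto intro: pseudohyp_dist_bounds \<mu>)
    finally show "P j (Suc n) \<le> P j n" by simp
  qed
  have lim_P: "P j \<longlonglongrightarrow> lim (P j)" for j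
  proof -
    obtain L where "P j \<longlonglongrightarrow> L"
      using decseq_convergent[OF P_decseq, of 0 j] P_nonneg by blast
    then show ?thesis by (simp add: limI)
  qed
  have "0 \<le> lim (P j)" for j
    using lim_P by (rule LIMSEQ_le_const) (use P_nonneg in blast)
  then have "(INF j. lim (P j)) \<le> lim (P 0)"
    by (intro cINF_lower) (auto intro!: bdd_belowI2)
  with pos have L: "0 < lim (P 0)" by linarith
  define \<kappa> where "\<kappa> = 1 - (cmod (\<mu> 0))\<^sup>2"
  have \<kappa>: "0 < \<kappa>" unfolding \<kappa>_def using \<mu>[of 0] by (simp add: power_less_one_iff abs_square_less_1)
  have "(\<Sum>i<n. 1 - cmod (\<mu> i)) \<le> 1 + 8 * (- ln (lim (P 0))) / \<kappa>" for n
  proof -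
    let ?A = "{..<n} - {0::nat}"
    have "lim (P 0) \<le> P 0 n"
      using decseq_ge[OF P_decseq lim_P] .
    also have "\<dots> \<le> (\<Prod>i\<in>?A. exp (- (1 - pseudohyp_dist (\<mu> i) (\<mu> 0))))"
      unfolding P_def
    proof (rule prod_mono)
      fix i
      show "0 \<le> pseudohyp_dist (\<mu> i) (\<mu> 0) \<and>
          pseudohyp_dist (\<mu> i) (\<mu> 0) \<le> exp (- (1 - pseudohyp_dist (\<mu> i) (\<mu> 0)))"
        using exp_ge_add_one_self[of "- (1 - pseudohyp_dist (\<mu> i) (\<mu> 0))"]
          pseudohyp_dist_bounds(1)[OF \<mu> \<mu>, of i 0] by simp
    qed
    also have "\<dots> = exp (- (\<Sum>i\<in>?A. 1 - pseudohyp_dist (\<mu> i) (\<mu> 0)))"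
      by (simp add: exp_sum flip: sum_negf)
    finally have dist_sum: "(\<Sum>i\<in>?A. 1 - pseudohyp_dist (\<mu> i) (\<mu> 0)) \<le> - ln (lim (P 0))"
      using ln_mono[OF _ L] by fastforce
    have "\<kappa> * (\<Sum>i\<in>?A. 1 - cmod (\<mu> i)) \<le> 8 * (\<Sum>i\<in>?A. 1 - pseudohyp_dist (\<mu> i) (\<mu> 0))"
      unfolding sum_distrib_left \<kappa>_def by (intro sum_mono pseudohyp_dist_bounds \<mu>)
    with dist_sum have "\<kappa> * (\<Sum>i\<in>?A. 1 - cmod (\<mu> i)) \<le> 8 * (- ln (lim (P 0)))"
      by linarith
    then have "(\<Sum>i\<in>?A. 1 - cmod (\<mu> i)) \<le> 8 * (- ln (lim (P 0))) / \<kappa>"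
      using \<kappa> by (simp add: field_simps)
    moreover have "(\<Sum>i<n. 1 - cmod (\<mu> i)) \<le> (\<Sum>i\<in>insert 0 ?A. 1 - cmod (\<mu> i))"
      using \<mu> by (intro sum_mono2) (auto simp: less_imp_le)
    moreover have "(\<Sum>i\<in>insert 0 ?A. 1 - cmod (\<mu> i)) = 1 - cmod (\<mu> 0) + (\<Sum>i\<in>?A. 1 - cmod (\<mu> i))"
      by (subst sum.insert) auto
    ultimately show ?thesis
      using norm_ge_zero[of "\<mu> 0"] by linarith
  qed
  then show ?thesis
    using \<mu> by (intro summableI_nonneg_bounded) (auto simp: less_imp_le)
qed

lemma finite_union_carleson_imp_Blaschke_condition:
  assumes "finite_union_carleson S"
  shows "(\<lambda>z. 1 - cmod z) summable_on S"
proof -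
  have range: "(\<lambda>z. 1 - cmod z) summable_on range \<mu>" if "carleson_seq \<mu>" for \<mu>
  proof -
    have "inj \<mu>" "\<And>i. cmod (\<mu> i) < 1"
      using that unfolding carleson_seq_def by (auto simp: image_subset_iff)
    then show ?thesis
      using carleson_seq_imp_Blaschke_condition[OF that]
      by (simp add: summable_on_reindex o_def summable_on_UNIV_nonneg_real_iff less_imp_le)
  qed
  from assms obtain M where M: "finite M" "\<forall>\<mu>\<in>M. carleson_seq \<mu>" "S = (\<Union>\<mu>\<in>M. range \<mu>)"
    unfolding finite_union_carleson_def by blast
  have "(\<lambda>z. 1 - cmod z) summable_on (\<Union>\<mu>\<in>M. range \<mu>)"
    using M(1,2)
  proof (induction M rule: finite_induct)
    case (insert \<mu> M)
    let ?U = "\<Union>\<mu>\<in>M. range \<mu>"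
    have "carleson_seq \<mu>" using insert.prems by simp
    from range[OF this] have "(\<lambda>z. 1 - cmod z) summable_on (range \<mu> - ?U)"
      by (rule summable_on_subset_banach) blast
    moreover have "(\<lambda>z. 1 - cmod z) summable_on ?U"
      using insert by simp
    ultimately have "(\<lambda>z. 1 - cmod z) summable_on ((range \<mu> - ?U) \<union> ?U)"
      by (intro summable_on_Un_disjoint) auto
    then show ?case by simp
  qed simp
  then show ?thesis by (simp only: M(3))
qed

section \<open>Equality of the traces\<close>

text \<open>
  With this bound the Blaschke condition passes from the nodes to their powers.
\<close>
lemma one_minus_powr_le:
  assumes t: "0 \<le> t" "t \<le> (1::real)" and p: "p > 0"
  shows "1 - t powr p \<le> real (nat \<lceil>p\<rceil>) * (1 - t)"
proof -
  define n where "n = nat \<lceil>p\<rceil>"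
  have n: "n \<noteq> 0" "p \<le> real n"
    using p by (auto simp: n_def)
  have "1 + real n * (t - 1) \<le> (1 + (t - 1)) ^ n"
    using t by (intro Bernoulli_inequality) auto
  also have "\<dots> = t powr real n"
    using t n by (simp add: powr_realpow')
  also have "\<dots> \<le> t powr p"
    using t n by (intro powr_mono') auto
  finally show ?thesis by (simp add: n_def algebra_simps)
qed

theorem theorem3p8:
  fixes l :: "nat \<Rightarrow> real" and p :: real
  assumes "range l \<subseteq> {0..<1}"
    and "inj l"
    and "finite_union_carleson (range (\<lambda>j. complex_of_real (l j)))"
    and "p > 0"
  shows "H2_trace (\<lambda>j. complex_of_real (l j)) = H2_trace (\<lambda>j. complex_of_real (l j powr p))"
proof
  have l: "0 \<le> l j \<and> l j < 1" for j
    using assms(1) by (auto simp: image_subset_iff)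
  have "inj (\<lambda>j. complex_of_real (l j))"
    using assms(2) by (simp add: inj_def)
  then have summable: "summable (\<lambda>j. 1 - l j)"
    using finite_union_carleson_imp_Blaschke_condition[OF assms(3)] l
    by (simp add: summable_on_reindex o_def summable_on_UNIV_nonneg_real_iff less_imp_le)
  then show "H2_trace (\<lambda>j. complex_of_real (l j powr p)) \<subseteq> H2_trace (\<lambda>j. complex_of_real (l j))"
    using l assms by (intro H2_trace_powr_subset) auto
  \<comment> \<open>The powers are again nodes with the Blaschke condition, and the exponent \<open>1 / p\<close> leads back.\<close>
  define m where "m = (\<lambda>j. l j powr p)"
  have m: "0 \<le> m j \<and> m j < 1" for j
    using l[of j] assms(4) powr_less_mono2[of p "l j" 1] by (simp add: m_def)
  have root: "m j powr (1 / p) = l j" for j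
    using l[of j] assms(4) by (simp add: m_def powr_powr)
  have "inj m"
  proof (rule injI)
    fix i j assume "m i = m j"
    then have "l i = l j" using root[of i] root[of j] by simp
    then show "i = j" using assms(2) by (simp add: inj_eq)
  qed
  have "summable (\<lambda>j. real (nat \<lceil>p\<rceil>) * (1 - l j))"
    by (intro summable_mult summable)
  then have "summable (\<lambda>j. 1 - m j)"
  proof (rule summable_comparison_test')
    show "norm (1 - m j) \<le> real (nat \<lceil>p\<rceil>) * (1 - l j)" for j
      using one_minus_powr_le[of "l j" p] l[of j] m[of j] assms(4) by (simp add: m_def)
  qed
  then have "H2_trace (\<lambda>j. complex_of_real (m j powr (1 / p))) \<subseteq> H2_trace (\<lambda>j. complex_of_real (m j))"
    using m \<open>inj m\<close> assms(4) by (intro H2_trace_powr_subset) auto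
  then show "H2_trace (\<lambda>j. complex_of_real (l j)) \<subseteq> H2_trace (\<lambda>j. complex_of_real (l j powr p))"
    by (simp only: root) (simp only: m_def)
qed

end
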